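(* A rectifiable space $X$ is a $\mathfrak P_0$-space if and only if $X$ is a separable $T_0$-space with the strong Pytkeev property.
   Context: "Regular" means $T_3$. A topological space $X$ is rectifiable if there is a point $e\in X$ and a homeomorphism $H:X\times X\to X\times X$ such that $H(x,e)=(x,x)$ and $H(\{x\}\times X)=\{x\}\times X$ for every $x\in X$. A subset $A$ of a topological space $X$ accumulates at a point $x\in X$ if each neighborhood of $x$ contains infinitely many points of $A$. A family $\mathcal N$ of subsets of $X$ is a network at $x\in X$ if for any neighborhood $O_x$ of $x$ there is $N\in\mathcal N$ with $x\in N\subset O_x$. It is a Pytkeev network at $x$ if it is a network at $x$ and for each neighborhood $O_x$ of $x$ and each subset $A\subset X$ accumulating at $x$ there is $N\in\mathcal N$ such that $N\subset O_x$ and $N\cap A$ is infinite. It is a Pytkeev network for $X$ if it is a Pytkeev network at each point $x\in X$. A $\mathfrak P_0$-space is a regular space with a countable Pytkeev network. A space $X$ has the strong Pytkeev property if it has a countable Pytkeev network at each point $x\in X$. *)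

theory Defs
  imports "HOL-Analysis.Analysis"
begin

definition rectifiable_space :: "'a topology \<Rightarrow> bool" where
  "rectifiable_space X \<longleftrightarrow>
    (\<exists>e \<in> topspace X. \<exists>H :: 'a \<times> 'a \<Rightarrow> 'a \<times> 'a.
       homeomorphic_map (prod_topology X X) (prod_topology X X) H \<and>
       (\<forall>x \<in> topspace X. H (x, e) = (x, x) \<and>
          H ` ({x} \<times> topspace X) = {x} \<times> topspace X))"

(* Neighborhoods are taken open below; for each of the next three notions
   this agrees with using all sets that contain the point in their interior. *)

definition accumulates_at :: "'a topology \<Rightarrow> 'a set \<Rightarrow> 'a \<Rightarrow> bool" where
  "accumulates_at X A x \<longleftrightarrow> (\<forall>U. openin X U \<and> x \<in> U \<longrightarrow> infinite (U \<inter> A))"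

definition network_at :: "'a topology \<Rightarrow> 'a set set \<Rightarrow> 'a \<Rightarrow> bool" where
  "network_at X \<N> x \<longleftrightarrow>
    (\<forall>N \<in> \<N>. N \<subseteq> topspace X) \<and>
    (\<forall>U. openin X U \<and> x \<in> U \<longrightarrow> (\<exists>N \<in> \<N>. x \<in> N \<and> N \<subseteq> U))"

definition Pytkeev_network_at :: "'a topology \<Rightarrow> 'a set set \<Rightarrow> 'a \<Rightarrow> bool" where
  "Pytkeev_network_at X \<N> x \<longleftrightarrow>
    network_at X \<N> x \<and>
    (\<forall>U A. openin X U \<and> x \<in> U \<and> A \<subseteq> topspace X \<and> accumulates_at X A x \<longrightarrow>
       (\<exists>N \<in> \<N>. N \<subseteq> U \<and> infinite (N \<inter> A)))"

definition Pytkeev_network :: "'a topology \<Rightarrow> 'a set set \<Rightarrow> bool" where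
  "Pytkeev_network X \<N> \<longleftrightarrow> (\<forall>x \<in> topspace X. Pytkeev_network_at X \<N> x)"

(* Here "regular" means T3; the library's regular_space carries no separation
   axiom on points, hence the extra t1_space. *)
definition P0_space :: "'a topology \<Rightarrow> bool" where
  "P0_space X \<longleftrightarrow>
    regular_space X \<and> t1_space X \<and> (\<exists>\<N>. countable \<N> \<and> Pytkeev_network X \<N>)"

definition strong_Pytkeev_property :: "'a topology \<Rightarrow> bool" where
  "strong_Pytkeev_property X \<longleftrightarrow>
    (\<forall>x \<in> topspace X. \<exists>\<N>. countable \<N> \<and> Pytkeev_network_at X \<N> x)"

end

theory Submission
  imports Defs
begin

text \<open>
  A rectification of a space is a continuous replacement for the two operations
  \<open>p x y = x y\<close> and \<open>q x y = x\<^sup>-\<^sup>1 y\<close> of a topological group: all fibre maps \<open>p x\<close>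
  are homeomorphisms with inverse \<open>q x\<close>, and they carry the base point \<open>e\<close> to \<open>x\<close>.
  The single tool of the proof is continuity of \<open>p\<close> at \<open>(x, e)\<close>: every neighbourhood
  of \<open>x\<close> contains a product \<open>p ` (W \<times> V)\<close> with \<open>W\<close> around \<open>x\<close> and \<open>V\<close> around \<open>e\<close>.

  A space with a countable Pytkeev network is separable, since one point chosen from each
  nonempty member of a network gives a dense set; the other two properties are immediate.

  Conversely, a rectifiable space is regular: if \<open>p ` (W \<times> V) \<subseteq> U\<close>, then every point \<open>y\<close>
  of the closure of \<open>W\<close> satisfies \<open>q w y \<in> V\<close> for some \<open>w \<in> W\<close>, hence
  \<open>y = p w (q w y)\<close> lies in \<open>U\<close>. So the \<open>T\<^sub>0\<close> axiom gives \<open>T\<^sub>3\<close>. Now let \<open>D\<close> be a countable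
  dense set and \<open>\<N>\<close> a countable Pytkeev network at \<open>e\<close>. The translates \<open>p d ` N\<close> with
  \<open>d \<in> D\<close>, \<open>N \<in> \<N>\<close> form a network at every point \<open>x\<close>. The members of a network need not be
  neighbourhoods, so it is not enough to take \<open>d\<close> near \<open>x\<close>; the Pytkeev property of \<open>\<N>\<close>,
  applied to the set of all \<open>q d x\<close> with \<open>d\<close> near \<open>x\<close>, is what provides \<open>d\<close> and \<open>N\<close> with
  \<open>x \<in> p d ` N\<close>. Finally, if \<open>\<M>\<close> is a network at every point, then the products
  \<open>p ` (M \<times> N)\<close> form a Pytkeev network at every point \<open>x\<close>: the translate \<open>p x ` N\<close> meets a
  given set accumulating at \<open>x\<close> infinitely often, and the unknown point \<open>x\<close> is absorbed
  by a member \<open>M\<close> that contains it.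
\<close>

section \<open>Spaces with a countable network\<close>

lemma network_at_subset: "\<lbrakk>network_at X \<N> x; N \<in> \<N>\<rbrakk> \<Longrightarrow> N \<subseteq> topspace X"
  unfolding network_at_def by (elim conjE) (rule bspec)

lemma network_atE:
  assumes "network_at X \<N> x" "openin X U" "x \<in> U"
  obtains N where "N \<in> \<N>" "x \<in> N" "N \<subseteq> U"
  using assms unfolding network_at_def by meson

lemma Pytkeev_network_at_imp_network_at: "Pytkeev_network_at X \<N> x \<Longrightarrow> network_at X \<N> x"
  unfolding Pytkeev_network_at_def by (rule conjunct1)

lemma Pytkeev_network_atE:
  assumes "Pytkeev_network_at X \<N> x" "openin X U" "x \<in> U"
    and "A \<subseteq> topspace X" "accumulates_at X A x"
  obtains N where "N \<in> \<N>" "N \<subseteq> U" "infinite (N \<inter> A)"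
  using assms unfolding Pytkeev_network_at_def by meson

lemma separable_space_countable_network:
  assumes "countable \<N>" and net: "\<And>x. x \<in> topspace X \<Longrightarrow> network_at X \<N> x"
  shows "separable_space X"
proof -
  define C where "C = (\<lambda>N. SOME y. y \<in> N) ` (\<N> - {{}}) \<inter> topspace X"
  have "x \<in> X closure_of C" if x: "x \<in> topspace X" for x
    unfolding in_closure_of
  proof (intro conjI allI impI x)
    fix U assume U: "x \<in> U \<and> openin X U"
    then obtain N where N: "N \<in> \<N>" "x \<in> N" "N \<subseteq> U"
      using network_atE[OF net[OF x]] by metis
    moreover have "N \<subseteq> topspace X"
      using network_at_subset[OF net[OF x] N(1)] .
    moreover
    have "(SOME y. y \<in> N) \<in> N"
      using N(2) by (rule someI)
    ultimately show "\<exists>y. y \<in> C \<and> y \<in> U"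
      unfolding C_def by blast
  qed
  then have "X closure_of C = topspace X"
    by (meson closure_of_subset_topspace subsetI subset_antisym)
  moreover have "countable C" "C \<subseteq> topspace X"
    using assms(1) unfolding C_def by auto
  ultimately show ?thesis
    unfolding separable_space_def by blast
qed

lemma P0_space_imp_separable_t0_strong_Pytkeev:
  assumes "P0_space X"
  shows "separable_space X \<and> t0_space X \<and> strong_Pytkeev_property X"
proof -
  from assms obtain \<N> where N: "countable \<N>" "Pytkeev_network X \<N>" and "t1_space X"
    unfolding P0_space_def by blast
  then have "separable_space X"
    by (intro separable_space_countable_network[of \<N>])
      (auto simp: Pytkeev_network_def Pytkeev_network_at_def)
  moreover have "t0_space X"
    using \<open>t1_space X\<close> by (rule t1_imp_t0_space)
  moreover have "strong_Pytkeev_property X"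
    using N unfolding strong_Pytkeev_property_def Pytkeev_network_def by blast
  ultimately show ?thesis by blast
qed

section \<open>Rectifications as multiplication and left division\<close>

locale rectification =
  fixes X :: "'a topology" and e :: 'a and p q :: "'a \<Rightarrow> 'a \<Rightarrow> 'a"
  assumes e_in: "e \<in> topspace X"
    and continuous_p: "continuous_map (prod_topology X X) X (case_prod p)"
    and continuous_q: "continuous_map (prod_topology X X) X (case_prod q)"
    and p_e: "x \<in> topspace X \<Longrightarrow> p x e = x"
    and q_p: "\<lbrakk>x \<in> topspace X; y \<in> topspace X\<rbrakk> \<Longrightarrow> q x (p x y) = y"
    and p_q: "\<lbrakk>x \<in> topspace X; y \<in> topspace X\<rbrakk> \<Longrightarrow> p x (q x y) = y"

text \<open>
  A homeomorphism that maps each vertical fibre onto itself keeps the first coordinate, and so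
  does its inverse; \<open>p\<close> and \<open>q\<close> are the second coordinates of the two.
\<close>

lemma rectifiable_space_imp_rectification:
  assumes "rectifiable_space X"
  obtains e p q where "rectification X e p q"
proof -
  from assms obtain e H where e: "e \<in> topspace X"
    and H: "homeomorphic_map (prod_topology X X) (prod_topology X X) H"
    and He: "\<And>x. x \<in> topspace X \<Longrightarrow> H (x, e) = (x, x)"
    and Hfib: "\<And>x. x \<in> topspace X \<Longrightarrow> H ` ({x} \<times> topspace X) = {x} \<times> topspace X"
    unfolding rectifiable_space_def by blast
  from H obtain G where "homeomorphic_maps (prod_topology X X) (prod_topology X X) H G"
    using homeomorphic_map_maps by blast
  then have cont: "continuous_map (prod_topology X X) (prod_topology X X) H"
      "continuous_map (prod_topology X X) (prod_topology X X) G"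
    and GH: "\<And>x y. \<lbrakk>x \<in> topspace X; y \<in> topspace X\<rbrakk> \<Longrightarrow> G (H (x, y)) = (x, y)"
    and HG: "\<And>x y. \<lbrakk>x \<in> topspace X; y \<in> topspace X\<rbrakk> \<Longrightarrow> H (G (x, y)) = (x, y)"
    unfolding homeomorphic_maps_def by auto
  have fibH: "H (x, y) = (x, snd (H (x, y)))"
    if "x \<in> topspace X" "y \<in> topspace X" for x y
  proof -
    have "H (x, y) \<in> {x} \<times> topspace X"
      using Hfib[of x] that by blast
    then show ?thesis by auto
  qed
  have fibG: "G (x, y) = (x, snd (G (x, y)))"
    if "x \<in> topspace X" "y \<in> topspace X" for x y
  proof -
    have "(x, y) \<in> H ` ({x} \<times> topspace X)"
      using Hfib[of x] that by blast
    then obtain z where "z \<in> topspace X" "(x, y) = H (x, z)" by blast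
    then show ?thesis using GH[of x z] that by simp
  qed
  have "rectification X e (\<lambda>x y. snd (H (x, y))) (\<lambda>x y. snd (G (x, y)))"
  proof
    show "continuous_map (prod_topology X X) X (\<lambda>(x, y). snd (H (x, y)))"
      using continuous_map_compose[OF cont(1) continuous_map_snd]
      by (simp add: o_def case_prod_unfold)
    show "continuous_map (prod_topology X X) X (\<lambda>(x, y). snd (G (x, y)))"
      using continuous_map_compose[OF cont(2) continuous_map_snd]
      by (simp add: o_def case_prod_unfold)
    fix x y assume x: "x \<in> topspace X" and y: "y \<in> topspace X"
    show "snd (G (x, snd (H (x, y)))) = y"
      using fibH[OF x y] GH[OF x y] by (metis snd_conv)
    show "snd (H (x, snd (G (x, y)))) = y"
      using fibG[OF x y] HG[OF x y] by (metis snd_conv)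
  qed (use e He in simp_all)
  then show thesis by (rule that)
qed

context rectification
begin

lemma p_in: "\<lbrakk>x \<in> topspace X; y \<in> topspace X\<rbrakk> \<Longrightarrow> p x y \<in> topspace X"
  using continuous_map_image_subset_topspace[OF continuous_p] by auto

lemma q_in: "\<lbrakk>x \<in> topspace X; y \<in> topspace X\<rbrakk> \<Longrightarrow> q x y \<in> topspace X"
  using continuous_map_image_subset_topspace[OF continuous_q] by auto

lemma q_self: "x \<in> topspace X \<Longrightarrow> q x x = e"
  using q_p[of x e] e_in by (simp add: p_e)

lemma openin_q_left:
  assumes "y \<in> topspace X" "openin X V"
  shows "openin X {z \<in> topspace X. q z y \<in> V}"
proof -
  have "continuous_map X X (\<lambda>z. q z y)"
    using continuous_map_compose[OF continuous_map_pairedI[OF continuous_map_id] continuous_q,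
        of "\<lambda>z. y"] assms(1)
    by (simp add: o_def)
  then show ?thesis
    using assms(2) by (rule openin_continuous_map_preimage)
qed

lemma openin_q_right:
  assumes "x \<in> topspace X" "openin X V"
  shows "openin X {z \<in> topspace X. q x z \<in> V}"
proof -
  have "continuous_map X X (\<lambda>z. q x z)"
    using continuous_map_compose[OF continuous_map_pairedI[OF _ continuous_map_id] continuous_q,
        of "\<lambda>z. x"] assms(1)
    by (simp add: o_def)
  then show ?thesis
    using assms(2) by (rule openin_continuous_map_preimage)
qed

lemma neighbourhood_product:
  assumes "openin X U" "x \<in> U"
  obtains W V where "openin X W" "x \<in> W" "openin X V" "e \<in> V"
    "\<And>w v. \<lbrakk>w \<in> W; v \<in> V\<rbrakk> \<Longrightarrow> p w v \<in> U"
proof -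
  have x: "x \<in> topspace X"
    using assms openin_subset by blast
  let ?P = "{z \<in> topspace (prod_topology X X). case_prod p z \<in> U}"
  have "openin (prod_topology X X) ?P"
    using continuous_p assms(1) by (rule openin_continuous_map_preimage)
  moreover have "(x, e) \<in> ?P"
    using x e_in assms(2) by (simp add: p_e)
  ultimately obtain W V where "openin X W" "openin X V" "x \<in> W" "e \<in> V" "W \<times> V \<subseteq> ?P"
    unfolding openin_prod_topology_alt by meson
  then show thesis
    by (intro that[of W V]) auto
qed

section \<open>Regularity\<close>

text \<open>
  With \<open>p w v \<in> U\<close> for all \<open>w \<in> W\<close> and \<open>v \<in> V\<close>, already the closure of \<open>W\<close> lies in \<open>U\<close>:
  since \<open>q y y = e\<close>, all \<open>z\<close> near a point \<open>y\<close> of this closure satisfy \<open>q z y \<in> V\<close>, and one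
  of them is in \<open>W\<close>.
\<close>

lemma regular_space_X: "regular_space X"
  unfolding regular_space
proof (intro allI impI)
  fix C a assume C: "closedin X C \<and> a \<in> topspace X - C"
  obtain W V where W: "openin X W" "a \<in> W" and V: "openin X V" "e \<in> V"
    and WV: "\<And>w v. \<lbrakk>w \<in> W; v \<in> V\<rbrakk> \<Longrightarrow> p w v \<in> topspace X - C"
    using neighbourhood_product[of "topspace X - C" a] C by blast
  have "y \<notin> C" if y: "y \<in> X closure_of W" for y
  proof -
    have yX: "y \<in> topspace X"
      using y by (simp add: in_closure_of)
    have "openin X {z \<in> topspace X. q z y \<in> V}"
      using yX V(1) by (rule openin_q_left)
    moreover have "y \<in> {z \<in> topspace X. q z y \<in> V}"
      using yX V(2) by (simp add: q_self)
    ultimately have "\<exists>w. w \<in> W \<and> w \<in> {z \<in> topspace X. q z y \<in> V}"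
      using y unfolding in_closure_of by (simp only:)
    then obtain w where w: "w \<in> W" "w \<in> topspace X" "q w y \<in> V"
      by auto
    then show ?thesis
      using WV[of w "q w y"] yX by (simp add: p_q)
  qed
  then show "\<exists>U. openin X U \<and> a \<in> U \<and> disjnt C (X closure_of U)"
    using W unfolding disjnt_def by blast
qed

section \<open>Translating a Pytkeev network\<close>

lemma accumulates_at_q_image:
  assumes x: "x \<in> topspace X" and A: "A \<subseteq> topspace X" "accumulates_at X A x"
  shows "accumulates_at X (q x ` A) e"
  unfolding accumulates_at_def
proof (intro allI impI)
  fix V assume V: "openin X V \<and> e \<in> V"
  let ?U = "{z \<in> topspace X. q x z \<in> V}"
  have "infinite (?U \<inter> A)"
    using A(2) openin_q_right[OF x] V q_self[OF x] x unfolding accumulates_at_def by auto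
  moreover have "inj_on (q x) (?U \<inter> A)"
    by (rule inj_on_inverseI[of _ "p x"]) (simp add: p_q x)
  ultimately have "infinite (q x ` (?U \<inter> A))"
    by (simp add: finite_image_iff)
  moreover have "q x ` (?U \<inter> A) \<subseteq> V \<inter> q x ` A"
    by blast
  ultimately show "infinite (V \<inter> q x ` A)"
    by (rule infinite_super[rotated])
qed

text \<open>
  Points \<open>d\<close> of \<open>D\<close> close to \<open>x\<close> have \<open>q d x\<close> close to \<open>e\<close>. By the \<open>T\<^sub>1\<close> axiom, either the values \<open>q d x\<close> accumulate
  at \<open>e\<close>, and some \<open>N \<in> \<N>\<close> contains one of them, or \<open>q d x = e\<close> for some \<open>d\<close>, and any \<open>N\<close>
  around \<open>e\<close> serves. In both cases \<open>x = p d (q d x)\<close> lies in \<open>p d ` N\<close>.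
\<close>

lemma network_at_translates:
  assumes t1: "t1_space X"
    and D: "D \<subseteq> topspace X" "X closure_of D = topspace X"
    and N: "Pytkeev_network_at X \<N> e"
    and x: "x \<in> topspace X"
  shows "network_at X {p d ` N |d N. d \<in> D \<and> N \<in> \<N>} x"
  unfolding network_at_def
proof (intro conjI ballI allI impI)
  have NX: "N \<subseteq> topspace X" if "N \<in> \<N>" for N
    using N[THEN Pytkeev_network_at_imp_network_at] that by (rule network_at_subset)
  show "K \<subseteq> topspace X" if "K \<in> {p d ` N |d N. d \<in> D \<and> N \<in> \<N>}" for K
    using that NX D(1) p_in by blast
  fix U assume U: "openin X U \<and> x \<in> U"
  obtain W V where W: "openin X W" "x \<in> W" and V: "openin X V" "e \<in> V"
    and WV: "\<And>w v. \<lbrakk>w \<in> W; v \<in> V\<rbrakk> \<Longrightarrow> p w v \<in> U"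
    using neighbourhood_product[of U x] U by blast
  define A where "A = (\<lambda>d. q d x) ` (D \<inter> W)"
  have AX: "A \<subseteq> topspace X"
    using D(1) x q_in unfolding A_def by blast
  have meet: "V' \<inter> A \<noteq> {}" if V': "openin X V'" "e \<in> V'" for V'
  proof -
    have "openin X (W \<inter> {z \<in> topspace X. q z x \<in> V'})"
      using W(1) openin_q_left[OF x V'(1)] by blast
    moreover have "x \<in> W \<inter> {z \<in> topspace X. q z x \<in> V'}"
      using W(2) x V'(2) by (simp add: q_self)
    moreover have "x \<in> X closure_of D"
      using D(2) x by simp
    ultimately have "\<exists>d. d \<in> D \<and> d \<in> W \<inter> {z \<in> topspace X. q z x \<in> V'}"
      unfolding in_closure_of by (simp only:)
    then obtain d where "d \<in> D" "d \<in> W" "q d x \<in> V'"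
      by auto
    then show ?thesis unfolding A_def by blast
  qed
  have "\<exists>N\<in>\<N>. N \<subseteq> V \<and> N \<inter> A \<noteq> {}"
  proof (cases "e \<in> A")
    case True
    obtain N' where "N' \<in> \<N>" "e \<in> N'" "N' \<subseteq> V"
      using N[THEN Pytkeev_network_at_imp_network_at] V by (rule network_atE)
    with True show ?thesis by blast
  next
    case False
    have "accumulates_at X A e"
      unfolding accumulates_at_def
    proof (intro allI impI notI)
      fix V' assume V': "openin X V' \<and> e \<in> V'" and fin: "finite (V' \<inter> A)"
      have "closedin X (V' \<inter> A)"
        using t1 fin AX by (auto simp: t1_space_closedin_finite)
      then have "openin X (V' - V' \<inter> A)"
        using V' by (intro openin_diff) auto
      then show False
        using meet[of "V' - V' \<inter> A"] V' False by blast
    qed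
    with N V AX obtain N' where "N' \<in> \<N>" "N' \<subseteq> V" "infinite (N' \<inter> A)"
      by (rule Pytkeev_network_atE)
    then show ?thesis
      by (metis finite.emptyI)
  qed
  then obtain N' d where N': "N' \<in> \<N>" "N' \<subseteq> V" and d: "d \<in> D" "d \<in> W" "q d x \<in> N'"
    unfolding A_def by blast
  have "x = p d (q d x)"
    using p_q d(1) D(1) x by auto
  then have "x \<in> p d ` N'"
    using d(3) by blast
  moreover have "p d ` N' \<subseteq> U"
    using WV d(2) N'(2) by blast
  ultimately show "\<exists>K\<in>{p d ` N |d N. d \<in> D \<and> N \<in> \<N>}. x \<in> K \<and> K \<subseteq> U"
    using N'(1) d(1) by blast
qed

text \<open>
  A set \<open>A\<close> accumulating at \<open>x\<close> is carried by \<open>q x\<close> to one accumulating at \<open>e\<close>, so some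
  \<open>p x ` N\<close> meets \<open>A\<close> infinitely often. Replacing \<open>x\<close> by a small \<open>M \<in> \<M>\<close> around it only
  enlarges this set and removes the dependence on \<open>x\<close>.
\<close>

lemma Pytkeev_network_at_products:
  assumes M: "network_at X \<M> x"
    and N: "Pytkeev_network_at X \<N> e"
    and x: "x \<in> topspace X"
  shows "Pytkeev_network_at X {case_prod p ` (M \<times> N) |M N. M \<in> \<M> \<and> N \<in> \<N>} x"
    (is "Pytkeev_network_at X ?F x")
proof -
  have MX: "M \<subseteq> topspace X" if "M \<in> \<M>" for M
    using M that by (rule network_at_subset)
  have NX: "N \<subseteq> topspace X" if "N \<in> \<N>" for N
    using N[THEN Pytkeev_network_at_imp_network_at] that by (rule network_at_subset)
  have sub: "\<exists>M\<in>\<M>. \<exists>V. x \<in> M \<and> openin X V \<and> e \<in> V \<and>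
      (\<forall>N. N \<subseteq> V \<longrightarrow> case_prod p ` (M \<times> N) \<subseteq> U)"
    if U: "openin X U" "x \<in> U" for U
  proof -
    obtain W V where W: "openin X W" "x \<in> W" and V: "openin X V" "e \<in> V"
      and WV: "\<And>w v. \<lbrakk>w \<in> W; v \<in> V\<rbrakk> \<Longrightarrow> p w v \<in> U"
      using neighbourhood_product[of U x] U by blast
    obtain M' where M': "M' \<in> \<M>" "x \<in> M'" "M' \<subseteq> W"
      using M W by (rule network_atE)
    have "case_prod p ` (M' \<times> N') \<subseteq> U" if "N' \<subseteq> V" for N'
      using WV M'(3) that by auto
    then show ?thesis using M' V by blast
  qed
  show ?thesis
    unfolding Pytkeev_network_at_def network_at_def
  proof (intro conjI ballI allI impI)
    show "K \<subseteq> topspace X" if K: "K \<in> ?F" for K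
    proof -
      obtain M' N' where "K = case_prod p ` (M' \<times> N')" "M' \<in> \<M>" "N' \<in> \<N>"
        using K by blast
      then show ?thesis
        using MX[of M'] NX[of N'] p_in by auto
    qed
    show "\<exists>K\<in>?F. x \<in> K \<and> K \<subseteq> U" if U: "openin X U \<and> x \<in> U" for U
    proof -
      obtain M' V where M': "M' \<in> \<M>" "x \<in> M'" and V: "openin X V" "e \<in> V"
        and sub': "\<And>N. N \<subseteq> V \<Longrightarrow> case_prod p ` (M' \<times> N) \<subseteq> U"
        using sub[of U] U by blast
      obtain N' where N': "N' \<in> \<N>" "e \<in> N'" "N' \<subseteq> V"
        using N[THEN Pytkeev_network_at_imp_network_at] V by (rule network_atE)
      have "x = case_prod p (x, e)"
        using x by (simp add: p_e)
      then have "x \<in> case_prod p ` (M' \<times> N')"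
        using M'(2) N'(2) by blast
      then show ?thesis using sub'[OF N'(3)] M'(1) N'(1) by blast
    qed
    show "\<exists>K\<in>?F. K \<subseteq> U \<and> infinite (K \<inter> A)"
      if UA: "openin X U \<and> x \<in> U \<and> A \<subseteq> topspace X \<and> accumulates_at X A x" for U A
    proof -
      obtain M' V where M': "M' \<in> \<M>" "x \<in> M'" and V: "openin X V" "e \<in> V"
        and sub': "\<And>N. N \<subseteq> V \<Longrightarrow> case_prod p ` (M' \<times> N) \<subseteq> U"
        using sub[of U] UA by blast
      have "q x ` A \<subseteq> topspace X"
        using UA q_in[OF x] by blast
      moreover have "accumulates_at X (q x ` A) e"
        using UA accumulates_at_q_image[OF x] by blast
      ultimately obtain N' where N': "N' \<in> \<N>" "N' \<subseteq> V" "infinite (N' \<inter> q x ` A)"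
        by (rule Pytkeev_network_atE[OF N V])
      have "N' \<inter> q x ` A \<subseteq> q x ` (case_prod p ` (M' \<times> N') \<inter> A)"
      proof
        fix z assume z: "z \<in> N' \<inter> q x ` A"
        then obtain a where a: "a \<in> A" "z = q x a" by blast
        then have "a = case_prod p (x, z)"
          using p_q[of x a] x UA by auto
        then have "a \<in> case_prod p ` (M' \<times> N')"
          using z M'(2) by blast
        then show "z \<in> q x ` (case_prod p ` (M' \<times> N') \<inter> A)"
          using a by blast
      qed
      then have "infinite (case_prod p ` (M' \<times> N') \<inter> A)"
        using N'(3) by (meson finite_surj)
      then show ?thesis
        using sub'[OF N'(2)] M'(1) N'(1) by blast
    qed
  qed
qed

lemma separable_t0_Pytkeev_imp_P0_space:
  assumes "separable_space X" "t0_space X"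
    and N: "countable \<N>" "Pytkeev_network_at X \<N> e"
  shows "P0_space X"
proof -
  have t1: "t1_space X"
    using regular_space_X assms(2) regular_t0_imp_Hausdorff_space Hausdorff_imp_t1_space by blast
  obtain D where D: "countable D" "D \<subseteq> topspace X" "X closure_of D = topspace X"
    using assms(1) unfolding separable_space_def by blast
  define \<M> where "\<M> = {p d ` N |d N. d \<in> D \<and> N \<in> \<N>}"
  define \<K> where "\<K> = {case_prod p ` (M \<times> N) |M N. M \<in> \<M> \<and> N \<in> \<N>}"
  have "\<M> = (\<lambda>(d, N). p d ` N) ` (D \<times> \<N>)"
    unfolding \<M>_def by auto
  then have "countable \<M>"
    using D(1) N(1) by simp
  moreover have "\<K> = (\<lambda>(M, N). case_prod p ` (M \<times> N)) ` (\<M> \<times> \<N>)"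
    unfolding \<K>_def by auto
  ultimately have "countable \<K>"
    using N(1) by simp
  moreover have "Pytkeev_network X \<K>"
    unfolding Pytkeev_network_def \<K>_def
  proof
    fix x assume x: "x \<in> topspace X"
    have "network_at X \<M> x"
      unfolding \<M>_def using t1 D(2,3) N(2) x by (rule network_at_translates)
    then show "Pytkeev_network_at X {case_prod p ` (M \<times> N) |M N. M \<in> \<M> \<and> N \<in> \<N>} x"
      using N(2) x by (rule Pytkeev_network_at_products)
  qed
  ultimately show ?thesis
    using regular_space_X t1 unfolding P0_space_def by blast
qed

end

section \<open>The characterization\<close>

theorem corollary5p2:
  fixes X :: "'a topology"
  assumes "rectifiable_space X"
  shows "P0_space X \<longleftrightarrow>
    separable_space X \<and> t0_space X \<and> strong_Pytkeev_property X"
proof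
  show "separable_space X \<and> t0_space X \<and> strong_Pytkeev_property X" if "P0_space X"
    using that by (rule P0_space_imp_separable_t0_strong_Pytkeev)
next
  assume R: "separable_space X \<and> t0_space X \<and> strong_Pytkeev_property X"
  obtain e p q where "rectification X e p q"
    using assms by (rule rectifiable_space_imp_rectification)
  then interpret rectification X e p q .
  obtain \<N> where "countable \<N>" "Pytkeev_network_at X \<N> e"
    using R e_in unfolding strong_Pytkeev_property_def by blast
  then show "P0_space X"
    using R separable_t0_Pytkeev_imp_P0_space by blast
qed

end
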